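(* For every real $c\in(0,1)$, the logic DP is strongly complete with respect to $[0,1]^c$: for every set of formulas $\Gamma$ and formula $\varphi$, $\Gamma\vdash_{\mathrm{DP}}\varphi$ iff every evaluation into $[0,1]^c$ sending all formulas of $\Gamma$ to $1$ sends $\varphi$ to $1$. Moreover, DP is not standard complete, but it is canonically complete.
   Context: MTL is the logic in the language $\{\&,\wedge,\to,\bot\}$ whose equivalent algebraic semantics is the variety of MTL-algebras (bounded, commutative, integral, prelinear residuated lattices $(A,*,\Rightarrow,\sqcap,\sqcup,0,1)$), with $\neg\varphi:=\varphi\to\bot$, $\top:=\neg\bot$, $\varphi\vee\psi:=((\varphi\to\psi)\to\psi)\wedge((\psi\to\varphi)\to\varphi)$. The logic DP is MTL extended with the axiom schema $\varphi\vee\neg(\varphi\&\varphi)$; its algebraic semantics is the variety $\mathbb{DP}$ generated by drastic product chains (MTL-chains with $x*y=0$ whenever $x,y<1$ and $x*y=\min\{x,y\}$ otherwise). For $c\in(0,1)$, $[0,1]^c$ is the algebra $([0,c]\cup\{1\},*,\Rightarrow,\min,\max,0,1)$ with $x*y=0$ if $x,y<1$, $x*y=\min\{x,y\}$ otherwise, and $x\Rightarrow y=1$ if $x\le y$, $=c$ if $1>x>y$, $=y$ if $x=1$. An axiomatic extension L of MTL (with variety $\mathbb{L}$) is standard complete if $\mathbb{L}$ is generated by a set of standard algebras, i.e. L-chains whose lattice reduct is $([0,1],\le_{\mathbb{R}})$. L is canonically complete if it is complete with respect to a single algebra $\mathcal{A}$ (generating $\mathbb{L}$) such that: the lattice reduct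 of $\mathcal{A}$ is a sublattice of $([0,1],\le_{\mathbb{R}})$; and for every L-chain $\mathcal{B}$ whose lattice reduct is a sublattice of $([0,1],\le_{\mathbb{R}})$ there is $\mathcal{A}'\cong\mathcal{A}$ such that $(B,\le_B)$ is a sublattice of $(A',\le_{A'})$. *)

theory Defs
  imports Complex_Main
begin

section \<open>Formulas and Hilbert calculi\<close>

datatype fm =
    Var nat
  | Bot
  | Conj fm fm  (infixr \<open>\<^bold>&\<close> 70)
  | Meet fm fm  (infixr \<open>\<^bold>\<and>\<close> 65)
  | Imp fm fm   (infixr \<open>\<^bold>\<longrightarrow>\<close> 55)

definition Neg :: "fm \<Rightarrow> fm"  (\<open>\<^bold>\<not> _\<close> [80] 80)
  where "\<^bold>\<not> \<phi> = \<phi> \<^bold>\<longrightarrow> Bot"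

definition Join :: "fm \<Rightarrow> fm \<Rightarrow> fm"  (infixr \<open>\<^bold>\<or>\<close> 60)
  where "\<phi> \<^bold>\<or> \<psi> = ((\<phi> \<^bold>\<longrightarrow> \<psi>) \<^bold>\<longrightarrow> \<psi>) \<^bold>\<and> ((\<psi> \<^bold>\<longrightarrow> \<phi>) \<^bold>\<longrightarrow> \<phi>)"

text \<open>The standard Hilbert-style axiomatisation of MTL (Esteva and Godo).\<close>

inductive_set mtl_axioms :: "fm set" where
  A1: "(\<phi> \<^bold>\<longrightarrow> \<psi>) \<^bold>\<longrightarrow> ((\<psi> \<^bold>\<longrightarrow> \<chi>) \<^bold>\<longrightarrow> (\<phi> \<^bold>\<longrightarrow> \<chi>)) \<in> mtl_axioms"
| A2: "\<phi> \<^bold>& \<psi> \<^bold>\<longrightarrow> \<phi> \<in> mtl_axioms"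
| A3: "\<phi> \<^bold>& \<psi> \<^bold>\<longrightarrow> \<psi> \<^bold>& \<phi> \<in> mtl_axioms"
| A4: "\<phi> \<^bold>\<and> \<psi> \<^bold>\<longrightarrow> \<phi> \<in> mtl_axioms"
| A5: "\<phi> \<^bold>\<and> \<psi> \<^bold>\<longrightarrow> \<psi> \<^bold>\<and> \<phi> \<in> mtl_axioms"
| A6: "\<phi> \<^bold>& (\<phi> \<^bold>\<longrightarrow> \<psi>) \<^bold>\<longrightarrow> \<psi> \<^bold>\<and> \<phi> \<in> mtl_axioms"
| A7a: "(\<phi> \<^bold>\<longrightarrow> (\<psi> \<^bold>\<longrightarrow> \<chi>)) \<^bold>\<longrightarrow> (\<phi> \<^bold>& \<psi> \<^bold>\<longrightarrow> \<chi>) \<in> mtl_axioms"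
| A7b: "(\<phi> \<^bold>& \<psi> \<^bold>\<longrightarrow> \<chi>) \<^bold>\<longrightarrow> (\<phi> \<^bold>\<longrightarrow> (\<psi> \<^bold>\<longrightarrow> \<chi>)) \<in> mtl_axioms"
| A8: "((\<phi> \<^bold>\<longrightarrow> \<psi>) \<^bold>\<longrightarrow> \<chi>) \<^bold>\<longrightarrow> (((\<psi> \<^bold>\<longrightarrow> \<phi>) \<^bold>\<longrightarrow> \<chi>) \<^bold>\<longrightarrow> \<chi>) \<in> mtl_axioms"
| A9: "Bot \<^bold>\<longrightarrow> \<phi> \<in> mtl_axioms"

text \<open>An axiomatic extension of MTL is represented by the set \<open>Ax\<close> of all instances of
  its additional axiom schemata.\<close>

inductive derives :: "fm set \<Rightarrow> fm set \<Rightarrow> fm \<Rightarrow> bool" for Ax \<Gamma> where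
  mtl: "\<phi> \<in> mtl_axioms \<Longrightarrow> derives Ax \<Gamma> \<phi>"
| ext: "\<phi> \<in> Ax \<Longrightarrow> derives Ax \<Gamma> \<phi>"
| hyp: "\<phi> \<in> \<Gamma> \<Longrightarrow> derives Ax \<Gamma> \<phi>"
| mp:  "derives Ax \<Gamma> \<phi> \<Longrightarrow> derives Ax \<Gamma> (\<phi> \<^bold>\<longrightarrow> \<psi>) \<Longrightarrow> derives Ax \<Gamma> \<psi>"

definition DP :: "fm set"
  where "DP = {\<phi> \<^bold>\<or> \<^bold>\<not> (\<phi> \<^bold>& \<phi>) | \<phi>. True}"

section \<open>MTL-algebras\<close>

record 'a alg =
  carrier :: "'a set"
  mult :: "'a \<Rightarrow> 'a \<Rightarrow> 'a"
  resid :: "'a \<Rightarrow> 'a \<Rightarrow> 'a"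
  meet :: "'a \<Rightarrow> 'a \<Rightarrow> 'a"
  join :: "'a \<Rightarrow> 'a \<Rightarrow> 'a"
  zero :: 'a
  one :: 'a

definition le :: "'a alg \<Rightarrow> 'a \<Rightarrow> 'a \<Rightarrow> bool"
  where "le A x y \<longleftrightarrow> meet A x y = x"

locale sig_algebra =
  fixes A :: "'a alg"
  assumes zero_closed: "zero A \<in> carrier A"
    and one_closed: "one A \<in> carrier A"
    and mult_closed: "\<lbrakk>x \<in> carrier A; y \<in> carrier A\<rbrakk> \<Longrightarrow> mult A x y \<in> carrier A"
    and resid_closed: "\<lbrakk>x \<in> carrier A; y \<in> carrier A\<rbrakk> \<Longrightarrow> resid A x y \<in> carrier A"
    and meet_closed: "\<lbrakk>x \<in> carrier A; y \<in> carrier A\<rbrakk> \<Longrightarrow> meet A x y \<in> carrier A"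
    and join_closed: "\<lbrakk>x \<in> carrier A; y \<in> carrier A\<rbrakk> \<Longrightarrow> join A x y \<in> carrier A"

locale mtl_algebra = sig_algebra +
  assumes meet_comm: "\<lbrakk>x \<in> carrier A; y \<in> carrier A\<rbrakk> \<Longrightarrow> meet A x y = meet A y x"
    and join_comm: "\<lbrakk>x \<in> carrier A; y \<in> carrier A\<rbrakk> \<Longrightarrow> join A x y = join A y x"
    and meet_assoc: "\<lbrakk>x \<in> carrier A; y \<in> carrier A; z \<in> carrier A\<rbrakk>
      \<Longrightarrow> meet A (meet A x y) z = meet A x (meet A y z)"
    and join_assoc: "\<lbrakk>x \<in> carrier A; y \<in> carrier A; z \<in> carrier A\<rbrakk>
      \<Longrightarrow> join A (join A x y) z = join A x (join A y z)"
    and meet_absorb: "\<lbrakk>x \<in> carrier A; y \<in> carrier A\<rbrakk> \<Longrightarrow> meet A x (join A x y) = x"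
    and join_absorb: "\<lbrakk>x \<in> carrier A; y \<in> carrier A\<rbrakk> \<Longrightarrow> join A x (meet A x y) = x"
    and zero_least: "x \<in> carrier A \<Longrightarrow> le A (zero A) x"
    and one_greatest: "x \<in> carrier A \<Longrightarrow> le A x (one A)"
    and mult_comm: "\<lbrakk>x \<in> carrier A; y \<in> carrier A\<rbrakk> \<Longrightarrow> mult A x y = mult A y x"
    and mult_assoc: "\<lbrakk>x \<in> carrier A; y \<in> carrier A; z \<in> carrier A\<rbrakk>
      \<Longrightarrow> mult A (mult A x y) z = mult A x (mult A y z)"
    and mult_one: "x \<in> carrier A \<Longrightarrow> mult A x (one A) = x"
    and residuation: "\<lbrakk>x \<in> carrier A; y \<in> carrier A; z \<in> carrier A\<rbrakk>
      \<Longrightarrow> le A (mult A x z) y \<longleftrightarrow> le A z (resid A x y)"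
    and prelinear: "\<lbrakk>x \<in> carrier A; y \<in> carrier A\<rbrakk>
      \<Longrightarrow> join A (resid A x y) (resid A y x) = one A"

definition chain :: "'a alg \<Rightarrow> bool"
  where "chain A \<longleftrightarrow> (\<forall>x \<in> carrier A. \<forall>y \<in> carrier A. le A x y \<or> le A y x)"

definition isomorphic :: "'a alg \<Rightarrow> 'b alg \<Rightarrow> bool"
  where "isomorphic A B \<longleftrightarrow> (\<exists>h. bij_betw h (carrier A) (carrier B) \<and>
    h (zero A) = zero B \<and> h (one A) = one B \<and>
    (\<forall>x \<in> carrier A. \<forall>y \<in> carrier A.
      h (mult A x y) = mult B (h x) (h y) \<and> h (resid A x y) = resid B (h x) (h y) \<and>
      h (meet A x y) = meet B (h x) (h y) \<and> h (join A x y) = join B (h x) (h y)))"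

definition sublattice :: "'a alg \<Rightarrow> 'a alg \<Rightarrow> bool"
  where "sublattice A B \<longleftrightarrow> carrier A \<subseteq> carrier B \<and>
    (\<forall>x \<in> carrier A. \<forall>y \<in> carrier A. meet A x y = meet B x y \<and> join A x y = join B x y)"

definition real_sublattice :: "real alg \<Rightarrow> bool"
  where "real_sublattice A \<longleftrightarrow> carrier A \<subseteq> {0..1} \<and>
    (\<forall>x \<in> carrier A. \<forall>y \<in> carrier A. meet A x y = min x y \<and> join A x y = max x y)"

section \<open>Semantics of formulas\<close>

primrec eval :: "'a alg \<Rightarrow> (nat \<Rightarrow> 'a) \<Rightarrow> fm \<Rightarrow> 'a" where
  "eval A v (Var n) = v n"
| "eval A v Bot = zero A"
| "eval A v (\<phi> \<^bold>& \<psi>) = mult A (eval A v \<phi>) (eval A v \<psi>)"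
| "eval A v (\<phi> \<^bold>\<and> \<psi>) = meet A (eval A v \<phi>) (eval A v \<psi>)"
| "eval A v (\<phi> \<^bold>\<longrightarrow> \<psi>) = resid A (eval A v \<phi>) (eval A v \<psi>)"

definition entails :: "'a alg \<Rightarrow> fm set \<Rightarrow> fm \<Rightarrow> bool"
  where "entails A \<Gamma> \<phi> \<longleftrightarrow>
    (\<forall>v. range v \<subseteq> carrier A \<longrightarrow> (\<forall>\<gamma> \<in> \<Gamma>. eval A v \<gamma> = one A) \<longrightarrow> eval A v \<phi> = one A)"

section \<open>Varieties\<close>

text \<open>Terms over the full signature of MTL-algebras, in which the join and the unit are
  primitive (unlike in formulas).\<close>

datatype trm =
    TVar nat
  | TZero
  | TOne
  | TMult trm trm
  | TResid trm trm
  | TMeet trm trm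
  | TJoin trm trm

primrec teval :: "'a alg \<Rightarrow> (nat \<Rightarrow> 'a) \<Rightarrow> trm \<Rightarrow> 'a" where
  "teval A v (TVar n) = v n"
| "teval A v TZero = zero A"
| "teval A v TOne = one A"
| "teval A v (TMult s t) = mult A (teval A v s) (teval A v t)"
| "teval A v (TResid s t) = resid A (teval A v s) (teval A v t)"
| "teval A v (TMeet s t) = meet A (teval A v s) (teval A v t)"
| "teval A v (TJoin s t) = join A (teval A v s) (teval A v t)"

definition equational_class :: "(trm \<times> trm) set \<Rightarrow> 'a alg set"
  where "equational_class E = {A. sig_algebra A \<and>
    (\<forall>(s, t) \<in> E. \<forall>v. range v \<subseteq> carrier A \<longrightarrow> teval A v s = teval A v t)}"

text \<open>The least equational class containing \<open>K\<close>. The members of the variety may live on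
  a type \<open>'u\<close> different from that of the generating algebras.\<close>

definition generated_variety :: "'a alg set \<Rightarrow> 'u alg set"
  where "generated_variety K =
    \<Inter> {equational_class E | E. K \<subseteq> equational_class E}"

definition variety_of :: "fm set \<Rightarrow> 'u alg set"
  where "variety_of Ax = {A. mtl_algebra A \<and> (\<forall>\<phi> \<in> Ax. entails A {} \<phi>)}"

section \<open>Standard and canonical completeness\<close>

definition standard_algebra :: "fm set \<Rightarrow> real alg \<Rightarrow> bool"
  where "standard_algebra Ax A \<longleftrightarrow> A \<in> variety_of Ax \<and> chain A \<and>
    real_sublattice A \<and> carrier A = {0..1}"

text \<open>HOL has no class of all algebras, so the equality of varieties is stated for algebras
  with carriers in a type \<open>'u\<close>. Identities use countably many variables, hence a variety
  is determined by its members on any infinite \<open>'u\<close>.\<close>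

definition standard_complete :: "'u itself \<Rightarrow> fm set \<Rightarrow> bool"
  where "standard_complete _ Ax \<longleftrightarrow> (\<exists>K. (\<forall>A \<in> K. standard_algebra Ax A) \<and>
    (variety_of Ax :: 'u alg set) = generated_variety K)"

definition canonically_complete :: "'u itself \<Rightarrow> fm set \<Rightarrow> bool"
  where "canonically_complete _ Ax \<longleftrightarrow> (\<exists>A :: real alg.
    A \<in> variety_of Ax \<and>
    (\<forall>\<phi>. derives Ax {} \<phi> \<longleftrightarrow> entails A {} \<phi>) \<and>
    (variety_of Ax :: 'u alg set) = generated_variety {A} \<and>
    real_sublattice A \<and>
    (\<forall>B. B \<in> variety_of Ax \<and> chain B \<and> real_sublattice B \<longrightarrow>
      (\<exists>A' :: real alg. isomorphic A' A \<and> sublattice B A')))"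

section \<open>The algebra on \<open>[0,c] \<union> {1}\<close>\<close>

definition dp_algebra :: "real \<Rightarrow> real alg"
  where "dp_algebra c = \<lparr>
    carrier = {0..c} \<union> {1},
    mult = (\<lambda>x y. if x < 1 \<and> y < 1 then 0 else min x y),
    resid = (\<lambda>x y. if x \<le> y then 1 else if x < 1 then c else y),
    meet = min,
    join = max,
    zero = 0,
    one = 1\<rparr>"

end

theory Submission
  imports Defs "HOL-Library.Countable"
begin

text \<open>Strong completeness: if \<open>\<Gamma>\<close> does not prove \<open>\<phi>\<close>, extend \<open>\<Gamma>\<close> to a theory \<open>T\<close> that is maximal
  without proving \<open>\<phi>\<close>. Prelinearity makes \<open>T\<close> linear, so provability of implications is a total
  preorder on the countable set of formulas. The axiom of DP says that the product of two formulas
  unprovable in \<open>T\<close> is refutable, hence the negation of an unprovable, irrefutable formula is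
  a largest unprovable formula. Mapping each unprovable formula to a real number by an order
  embedding, scaled so that this largest one is sent to \<open>c\<close>, and the provable formulas to \<open>1\<close>,
  is an evaluation into \<open>[0,1]\<^sup>c\<close>.

  The same argument with negations shows that a DP-chain with more than two elements has a coatom.
  Since \<open>[0,1]\<close> has none, there are no standard DP-algebras, while every DP-chain inside \<open>[0,1]\<close>
  lies in an interval plus one larger point, which is order isomorphic to \<open>[0,c] \<union> {1}\<close>.\<close>

section \<open>MTL-algebras and soundness\<close>

context mtl_algebra
begin

lemmas closed [simp] = zero_closed one_closed mult_closed resid_closed meet_closed join_closed

lemma meet_idem: "x \<in> carrier A \<Longrightarrow> meet A x x = x"
  by (metis join_absorb meet_absorb meet_closed)

lemma le_refl [simp]: "x \<in> carrier A \<Longrightarrow> le A x x"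
  by (simp add: le_def meet_idem)

lemma le_antisym: "\<lbrakk>le A x y; le A y x; x \<in> carrier A; y \<in> carrier A\<rbrakk> \<Longrightarrow> x = y"
  by (metis le_def meet_comm)

lemma le_trans: "\<lbrakk>le A x y; le A y z; x \<in> carrier A; y \<in> carrier A; z \<in> carrier A\<rbrakk> \<Longrightarrow> le A x z"
  by (metis le_def meet_assoc)

lemma meet_le1: "\<lbrakk>x \<in> carrier A; y \<in> carrier A\<rbrakk> \<Longrightarrow> le A (meet A x y) x"
  by (metis le_def meet_assoc meet_comm meet_idem meet_closed)

lemma meet_le2: "\<lbrakk>x \<in> carrier A; y \<in> carrier A\<rbrakk> \<Longrightarrow> le A (meet A x y) y"
  by (metis meet_comm meet_le1)

lemma meet_greatest:
  "\<lbrakk>le A z x; le A z y; x \<in> carrier A; y \<in> carrier A; z \<in> carrier A\<rbrakk> \<Longrightarrow> le A z (meet A x y)"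
  by (metis le_def meet_assoc)

lemma le_iff_join: "\<lbrakk>x \<in> carrier A; y \<in> carrier A\<rbrakk> \<Longrightarrow> le A x y \<longleftrightarrow> join A x y = y"
  by (metis join_absorb join_comm le_def meet_absorb meet_comm)

lemma join_ge1: "\<lbrakk>x \<in> carrier A; y \<in> carrier A\<rbrakk> \<Longrightarrow> le A x (join A x y)"
  by (simp add: le_def meet_absorb)

lemma join_ge2: "\<lbrakk>x \<in> carrier A; y \<in> carrier A\<rbrakk> \<Longrightarrow> le A y (join A x y)"
  by (metis join_comm join_ge1)

lemma join_least:
  "\<lbrakk>le A x z; le A y z; x \<in> carrier A; y \<in> carrier A; z \<in> carrier A\<rbrakk> \<Longrightarrow> le A (join A x y) z"
  by (metis join_assoc join_closed le_iff_join)

lemma residuation_comm: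
  "\<lbrakk>x \<in> carrier A; y \<in> carrier A; z \<in> carrier A\<rbrakk> \<Longrightarrow> le A (mult A x z) y \<longleftrightarrow> le A x (resid A z y)"
  by (metis mult_comm residuation)

lemma resid_eq_one: "\<lbrakk>x \<in> carrier A; y \<in> carrier A\<rbrakk> \<Longrightarrow> resid A x y = one A \<longleftrightarrow> le A x y"
  by (metis le_antisym le_refl mult_one one_closed one_greatest resid_closed residuation)

lemma modus_ponens_le:
  "\<lbrakk>x \<in> carrier A; y \<in> carrier A\<rbrakk> \<Longrightarrow> le A (mult A x (resid A x y)) y"
  by (simp add: residuation)

lemma mult_mono:
  "\<lbrakk>le A x y; x \<in> carrier A; y \<in> carrier A; z \<in> carrier A\<rbrakk> \<Longrightarrow> le A (mult A z x) (mult A z y)"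
  by (meson le_refl le_trans mult_closed resid_closed residuation)

lemma mult_le1: "\<lbrakk>x \<in> carrier A; y \<in> carrier A\<rbrakk> \<Longrightarrow> le A (mult A x y) x"
  by (metis mult_mono mult_one one_closed one_greatest)

text \<open>Case distinction by prelinearity: residuation puts both residua below
  \<open>resid A w z\<close>, and their join is \<open>one A\<close>.\<close>

lemma prelinear_le:
  assumes "x \<in> carrier A" "y \<in> carrier A" "w \<in> carrier A" "z \<in> carrier A"
    and "le A (mult A (resid A x y) w) z" "le A (mult A (resid A y x) w) z"
  shows "le A w z"
proof -
  have "le A (join A (resid A x y) (resid A y x)) (resid A w z)"
    using assms by (intro join_least) (simp_all flip: residuation_comm)
  then have "le A (one A) (resid A w z)"
    using assms by (simp add: prelinear)
  then show ?thesis
    using assms by (metis le_antisym one_closed one_greatest resid_closed resid_eq_one)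
qed

text \<open>Links the formula \<open>Join\<close>, built from implication and meet, to the primitive
  join. For the harder inequality, multiplying by \<open>resid A x y\<close> reduces the first
  meetand to at most \<open>y\<close>, and multiplying by \<open>resid A y x\<close> reduces the
  second to at most \<open>x\<close>.\<close>

lemma join_eq_resid:
  assumes x: "x \<in> carrier A" and y: "y \<in> carrier A"
  shows "meet A (resid A (resid A x y) y) (resid A (resid A y x) x) = join A x y" (is "?w = _")
proof (rule le_antisym)
  have ub: "le A a (resid A (resid A a b) b)" "le A a (resid A (resid A b a) a)"
    if "a \<in> carrier A" "b \<in> carrier A" for a b
    using that by (simp_all add: modus_ponens_le mult_le1 flip: residuation_comm)
  show "le A (join A x y) ?w"
    using x y ub by (intro join_least meet_greatest) simp_all
  have half: "le A (mult A (resid A a b) ?w) (join A x y)"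
    if "le A ?w (resid A (resid A a b) b)" "le A b (join A x y)"
      "a \<in> carrier A" "b \<in> carrier A" for a b
  proof (rule le_trans)
    show "le A (mult A (resid A a b) ?w) b"
      using that x y by (simp add: residuation)
  qed (use that x y in simp_all)
  show "le A ?w (join A x y)"
  proof (rule prelinear_le)
    show "le A (mult A (resid A x y) ?w) (join A x y)"
      using x y by (intro half meet_le1 join_ge2) simp_all
    show "le A (mult A (resid A y x) ?w) (join A x y)"
      using x y by (intro half meet_le2 join_ge1) simp_all
  qed (use x y in simp_all)
qed (use x y in simp_all)

section \<open>Evaluation of formulas and soundness\<close>

lemma eval_closed: "range v \<subseteq> carrier A \<Longrightarrow> eval A v \<phi> \<in> carrier A"
  by (induction \<phi>) auto

lemma eval_Join:
  "range v \<subseteq> carrier A \<Longrightarrow> eval A v (\<phi> \<^bold>\<or> \<psi>) = join A (eval A v \<phi>) (eval A v \<psi>)"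
  by (simp add: Join_def join_eq_resid eval_closed)

lemma resid_trans:
  assumes "x \<in> carrier A" "y \<in> carrier A" "z \<in> carrier A"
  shows "le A (resid A x y) (resid A (resid A y z) (resid A x z))"
proof -
  let ?p = "resid A x y" and ?q = "resid A y z"
  have "le A (mult A ?q (mult A x ?p)) (mult A ?q y)"
    using assms by (simp add: modus_ponens_le mult_mono)
  moreover have "le A (mult A ?q y) z"
    using assms by (simp add: residuation_comm)
  ultimately have "le A (mult A ?q (mult A x ?p)) z"
    using assms by (meson closed(3,4) le_trans)
  then have "le A (mult A x (mult A ?q ?p)) z"
    using assms by (metis closed(4) mult_assoc mult_comm)
  then show ?thesis
    using assms by (simp add: residuation)
qed

lemma mtl_axioms_sound:
  assumes "\<phi> \<in> mtl_axioms" and v: "range v \<subseteq> carrier A"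
  shows "eval A v \<phi> = one A"
  using assms(1)
proof cases
  case (A1 \<phi> \<psi> \<chi>)
  then show ?thesis using v by (simp add: resid_eq_one eval_closed resid_trans)
next
  case (A6 \<phi> \<psi>)
  then show ?thesis using v
    by (simp add: resid_eq_one eval_closed meet_greatest modus_ponens_le mult_le1)
next
  case (A7a \<phi> \<psi> \<chi>)
  let ?x = "eval A v \<phi>" and ?y = "eval A v \<psi>" and ?z = "eval A v \<chi>"
  let ?u = "resid A ?x (resid A ?y ?z)"
  have c: "?x \<in> carrier A" "?y \<in> carrier A" "?z \<in> carrier A"
    using v by (simp_all add: eval_closed)
  have "le A (mult A ?x ?u) (resid A ?y ?z)"
    using c by (simp add: modus_ponens_le)
  then have "le A (mult A ?y (mult A ?x ?u)) ?z"
    using c by (simp add: residuation)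
  then have "le A (mult A (mult A ?x ?y) ?u) ?z"
    using c by (metis closed(3,4) mult_assoc mult_comm)
  then show ?thesis
    using c A7a by (simp add: resid_eq_one residuation)
next
  case (A7b \<phi> \<psi> \<chi>)
  let ?x = "eval A v \<phi>" and ?y = "eval A v \<psi>" and ?z = "eval A v \<chi>"
  let ?u = "resid A (mult A ?x ?y) ?z"
  have c: "?x \<in> carrier A" "?y \<in> carrier A" "?z \<in> carrier A"
    using v by (simp_all add: eval_closed)
  have "le A (mult A (mult A ?x ?y) ?u) ?z"
    using c by (simp add: modus_ponens_le)
  then have "le A (mult A ?y (mult A ?x ?u)) ?z"
    using c by (metis closed(3,4) mult_assoc mult_comm)
  then have "le A ?u (resid A ?x (resid A ?y ?z))"
    using c by (simp add: residuation)
  then show ?thesis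
    using c A7b by (simp add: resid_eq_one)
next
  case (A8 \<phi> \<psi> \<chi>)
  let ?x = "eval A v \<phi>" and ?y = "eval A v \<psi>" and ?z = "eval A v \<chi>"
  let ?a = "resid A ?x ?y" and ?b = "resid A ?y ?x"
  \<comment> \<open>The two premises of A8, uncurried. This product lies below both residua, so
    prelinearity bounds it by \<open>?z\<close>.\<close>
  let ?w = "mult A (resid A ?b ?z) (resid A ?a ?z)"
  have c: "?x \<in> carrier A" "?y \<in> carrier A" "?z \<in> carrier A"
    using v by (simp_all add: eval_closed)
  have "le A ?w (resid A ?a ?z)" "le A ?w (resid A ?b ?z)"
    using c by (metis closed(3,4) mult_comm mult_le1)+
  then have "le A ?w ?z"
    using c by (intro prelinear_le[of ?x ?y ?w ?z]) (simp_all add: residuation)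
  then show ?thesis
    using c A8 by (simp add: resid_eq_one residuation)
qed (use v in \<open>simp_all add: resid_eq_one eval_closed mult_le1 mult_comm meet_le1 meet_le2
      meet_comm zero_least\<close>)

end

lemma soundness:
  assumes A: "A \<in> variety_of Ax" and "derives Ax \<Gamma> \<phi>"
  shows "entails A \<Gamma> \<phi>"
proof -
  interpret mtl_algebra A
    using A by (simp add: variety_of_def)
  have "eval A v \<phi> = one A"
    if v: "range v \<subseteq> carrier A" and \<Gamma>: "\<forall>\<gamma>\<in>\<Gamma>. eval A v \<gamma> = one A" for v
    using \<open>derives Ax \<Gamma> \<phi>\<close>
  proof induction
    case (ext \<phi>)
    then show ?case
      using A v by (auto simp: variety_of_def entails_def)
  next
    case (mp \<phi> \<psi>)
    then show ?case
      using v by (metis eval.simps(5) eval_closed le_antisym one_closed one_greatest resid_eq_one)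
  qed (use v \<Gamma> mtl_axioms_sound in auto)
  then show ?thesis
    by (auto simp: entails_def)
qed

section \<open>The algebras \<open>dp_algebra c\<close> as members of the variety\<close>

lemma dp_algebra_simps [simp]:
  "carrier (dp_algebra c) = {0..c} \<union> {1}"
  "mult (dp_algebra c) = (\<lambda>x y. if x < 1 \<and> y < 1 then 0 else min x y)"
  "resid (dp_algebra c) = (\<lambda>x y. if x \<le> y then 1 else if x < 1 then c else y)"
  "meet (dp_algebra c) = min"
  "join (dp_algebra c) = max"
  "zero (dp_algebra c) = 0"
  "one (dp_algebra c) = 1"
  by (simp_all add: dp_algebra_def)

text \<open>For 1 > x > y, the carrier elements whose product with \<open>x\<close> is at most
  \<open>y\<close> are exactly those below 1. The largest of them is \<open>c\<close>, which is
  therefore the residuum.\<close>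

lemma mtl_algebra_dp_algebra:
  assumes "0 < c" "c < 1"
  shows "mtl_algebra (dp_algebra c)"
  by unfold_locales (use assms in \<open>auto simp: le_def min_def max_def split: if_splits\<close>)

lemma dp_algebra_in_variety:
  assumes "0 < c" "c < 1"
  shows "dp_algebra c \<in> variety_of DP"
proof -
  interpret mtl_algebra "dp_algebra c"
    using assms by (rule mtl_algebra_dp_algebra)
  have "eval (dp_algebra c) v (\<phi> \<^bold>\<or> \<^bold>\<not> (\<phi> \<^bold>& \<phi>)) = 1" if v: "range v \<subseteq> carrier (dp_algebra c)" for v \<phi>
    using eval_closed[OF v, of \<phi>] assms
    by (auto simp: eval_Join[OF v] Neg_def max_def)
  then show ?thesis
    using mtl_algebra_axioms by (auto simp: variety_of_def entails_def DP_def)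
qed

section \<open>Derivations in DP\<close>

abbreviation (input) DP_derives :: "fm set \<Rightarrow> fm \<Rightarrow> bool"  (infix \<open>\<tturnstile>\<close> 50)
  where "T \<tturnstile> \<phi> \<equiv> derives DP T \<phi>"

lemma derives_mono: "derives Ax \<Gamma> \<phi> \<Longrightarrow> \<Gamma> \<subseteq> \<Delta> \<Longrightarrow> derives Ax \<Delta> \<phi>"
  by (induction rule: derives.induct) (auto intro: derives.intros)

text \<open>Derivations are finitary: only modus ponens joins two sets of hypotheses, and in a chain
  one of them contains the other.\<close>

lemma derives_Union_chain:
  assumes "derives Ax (\<Union>C) \<phi>" "subset.chain S C" "C \<noteq> {}"
  shows "\<exists>T\<in>C. derives Ax T \<phi>"
  using assms(1)
proof induction
  case (mp \<phi> \<psi>)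
  then obtain T U where TU: "T \<in> C" "U \<in> C" "derives Ax T \<phi>" "derives Ax U (\<phi> \<^bold>\<longrightarrow> \<psi>)"
    by blast
  then consider "T \<subseteq> U" | "U \<subseteq> T"
    using assms(2) by (meson subset_chain_def)
  then show ?case
    using TU by cases (meson derives.mp derives_mono)+
qed (use assms(3) in \<open>auto intro: derives.intros\<close>)

section \<open>Residuated lattice reasoning inside the calculus\<close>

lemma imp_trans:
  assumes "T \<tturnstile> \<phi> \<^bold>\<longrightarrow> \<psi>" "T \<tturnstile> \<psi> \<^bold>\<longrightarrow> \<chi>"
  shows "T \<tturnstile> \<phi> \<^bold>\<longrightarrow> \<chi>"
  using assms by (meson derives.mp derives.mtl mtl_axioms.A1)

lemma residuate: "T \<tturnstile> \<phi> \<^bold>& \<psi> \<^bold>\<longrightarrow> \<chi> \<longleftrightarrow> T \<tturnstile> \<phi> \<^bold>\<longrightarrow> \<psi> \<^bold>\<longrightarrow> \<chi>"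
  by (meson derives.mp derives.mtl mtl_axioms.A7a mtl_axioms.A7b)

lemma Conj_commute: "T \<tturnstile> \<phi> \<^bold>& \<psi> \<^bold>\<longrightarrow> \<psi> \<^bold>& \<phi>"
  by (meson derives.mtl mtl_axioms.A3)

lemma imp_swap: "T \<tturnstile> \<phi> \<^bold>\<longrightarrow> \<psi> \<^bold>\<longrightarrow> \<chi> \<Longrightarrow> T \<tturnstile> \<psi> \<^bold>\<longrightarrow> \<phi> \<^bold>\<longrightarrow> \<chi>"
  by (meson Conj_commute imp_trans residuate)

lemma Conj_le1: "T \<tturnstile> \<phi> \<^bold>& \<psi> \<^bold>\<longrightarrow> \<phi>"
  by (meson derives.mtl mtl_axioms.A2)

lemma weakening: "T \<tturnstile> \<phi> \<^bold>\<longrightarrow> \<psi> \<^bold>\<longrightarrow> \<phi>"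
  using Conj_le1 residuate by blast

lemma imp_refl: "T \<tturnstile> \<phi> \<^bold>\<longrightarrow> \<phi>"
  by (meson Conj_le1 derives.mp imp_swap weakening)

lemma weaken: "T \<tturnstile> \<phi> \<Longrightarrow> T \<tturnstile> \<psi> \<^bold>\<longrightarrow> \<phi>"
  by (meson derives.mp weakening)

lemma Bot_le: "T \<tturnstile> Bot \<^bold>\<longrightarrow> \<phi>"
  by (meson derives.mtl mtl_axioms.A9)

lemma Meet_le1: "T \<tturnstile> \<phi> \<^bold>\<and> \<psi> \<^bold>\<longrightarrow> \<phi>"
  by (meson derives.mtl mtl_axioms.A4)

lemma Meet_commute: "T \<tturnstile> \<phi> \<^bold>\<and> \<psi> \<^bold>\<longrightarrow> \<psi> \<^bold>\<and> \<phi>"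
  by (meson derives.mtl mtl_axioms.A5)

lemma Meet_le2: "T \<tturnstile> \<phi> \<^bold>\<and> \<psi> \<^bold>\<longrightarrow> \<psi>"
  by (meson Meet_commute Meet_le1 imp_trans)

lemma Conj_imp_Meet: "T \<tturnstile> \<phi> \<^bold>& (\<phi> \<^bold>\<longrightarrow> \<psi>) \<^bold>\<longrightarrow> \<psi> \<^bold>\<and> \<phi>"
  by (meson derives.mtl mtl_axioms.A6)

lemma modus_ponens_imp: "T \<tturnstile> \<phi> \<^bold>\<longrightarrow> (\<phi> \<^bold>\<longrightarrow> \<psi>) \<^bold>\<longrightarrow> \<psi>"
  by (meson Conj_imp_Meet Meet_le1 imp_trans residuate)

lemma Conj_mono: "T \<tturnstile> \<phi> \<^bold>\<longrightarrow> \<psi> \<Longrightarrow> T \<tturnstile> \<phi> \<^bold>& \<chi> \<^bold>\<longrightarrow> \<psi> \<^bold>& \<chi>"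
  by (meson imp_refl imp_trans residuate)

lemma prelinear_cases:
  assumes "T \<tturnstile> (\<phi> \<^bold>\<longrightarrow> \<psi>) \<^bold>\<longrightarrow> \<chi>" "T \<tturnstile> (\<psi> \<^bold>\<longrightarrow> \<phi>) \<^bold>\<longrightarrow> \<chi>"
  shows "T \<tturnstile> \<chi>"
  using assms by (meson derives.mp derives.mtl mtl_axioms.A8)

text \<open>A6 produces a meet only from a formula multiplied by an implication. Hence the case
  split: under either implication between \<open>\<phi>\<close> and \<open>\<psi>\<close>, one of
  the assumptions and A6 suffice.\<close>

lemma Meet_greatest:
  assumes "T \<tturnstile> \<chi> \<^bold>\<longrightarrow> \<phi>" "T \<tturnstile> \<chi> \<^bold>\<longrightarrow> \<psi>"
  shows "T \<tturnstile> \<chi> \<^bold>\<longrightarrow> \<phi> \<^bold>\<and> \<psi>"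
proof (rule prelinear_cases)
  show "T \<tturnstile> (\<phi> \<^bold>\<longrightarrow> \<psi>) \<^bold>\<longrightarrow> \<chi> \<^bold>\<longrightarrow> \<phi> \<^bold>\<and> \<psi>"
    by (meson assms(1) Conj_imp_Meet Meet_commute imp_swap imp_trans residuate)
  show "T \<tturnstile> (\<psi> \<^bold>\<longrightarrow> \<phi>) \<^bold>\<longrightarrow> \<chi> \<^bold>\<longrightarrow> \<phi> \<^bold>\<and> \<psi>"
    by (meson assms(2) Conj_imp_Meet imp_swap imp_trans residuate)
qed

lemma Join_ge1: "T \<tturnstile> \<phi> \<^bold>\<longrightarrow> \<phi> \<^bold>\<or> \<psi>"
  unfolding Join_def by (intro Meet_greatest modus_ponens_imp weakening)

lemma Join_ge2: "T \<tturnstile> \<psi> \<^bold>\<longrightarrow> \<phi> \<^bold>\<or> \<psi>"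
  unfolding Join_def by (intro Meet_greatest modus_ponens_imp weakening)

text \<open>If \<open>\<phi>\<close> implies \<open>\<psi>\<close>, the first conjunct of the join
  reduces to \<open>\<psi>\<close>; under the converse implication the second reduces to
  \<open>\<phi>\<close>.\<close>

lemma Join_least:
  assumes "T \<tturnstile> \<phi> \<^bold>\<longrightarrow> \<chi>" "T \<tturnstile> \<psi> \<^bold>\<longrightarrow> \<chi>"
  shows "T \<tturnstile> \<phi> \<^bold>\<or> \<psi> \<^bold>\<longrightarrow> \<chi>"
proof (rule prelinear_cases)
  show "T \<tturnstile> (\<phi> \<^bold>\<longrightarrow> \<psi>) \<^bold>\<longrightarrow> \<phi> \<^bold>\<or> \<psi> \<^bold>\<longrightarrow> \<chi>"
    unfolding Join_def by (meson assms(2) Meet_le1 imp_swap imp_trans residuate)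
  show "T \<tturnstile> (\<psi> \<^bold>\<longrightarrow> \<phi>) \<^bold>\<longrightarrow> \<phi> \<^bold>\<or> \<psi> \<^bold>\<longrightarrow> \<chi>"
    unfolding Join_def by (meson assms(1) Meet_le2 imp_swap imp_trans residuate)
qed

text \<open>The deduction theorem of MTL is only local, with powers of the added hypothesis, so
  \<open>\<alpha>\<close> is not discharged into an implication. Instead \<open>\<beta>\<close> is
  carried as a disjunct through every step of the derivation.\<close>

lemma proof_by_cases_weak:
  assumes "insert \<alpha> T \<tturnstile> \<chi>" and "T \<tturnstile> \<alpha> \<^bold>\<or> \<beta>"
  shows "T \<tturnstile> \<chi> \<^bold>\<or> \<beta>"
  using assms(1)
proof induction
  case (mp \<phi> \<psi>)
  \<comment> \<open>Either disjunct of the induction hypothesis for the implication leads from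
    \<open>\<phi>\<close> to the goal; the hypothesis for \<open>\<phi>\<close> is then split in the
    same way.\<close>
  have "T \<tturnstile> (\<phi> \<^bold>\<longrightarrow> \<psi>) \<^bold>\<longrightarrow> \<phi> \<^bold>\<longrightarrow> \<psi> \<^bold>\<or> \<beta>"
    using Join_ge1 imp_trans imp_refl residuate by blast
  moreover have "T \<tturnstile> \<beta> \<^bold>\<longrightarrow> \<phi> \<^bold>\<longrightarrow> \<psi> \<^bold>\<or> \<beta>"
    using imp_trans[OF Join_ge2 weakening] .
  ultimately have "T \<tturnstile> \<phi> \<^bold>\<longrightarrow> \<psi> \<^bold>\<or> \<beta>"
    using derives.mp[OF mp.IH(2) Join_least] by blast
  then show ?case
    using derives.mp[OF mp.IH(1) Join_least[OF _ Join_ge2]] by blast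
next
  case (hyp \<chi>)
  then show ?case
    using assms(2) derives.mp[OF derives.hyp Join_ge1] by blast
qed (blast intro: derives.mp[OF derives.mtl Join_ge1] derives.mp[OF derives.ext Join_ge1])+

text \<open>Two uses of the weak form: the first replaces \<open>\<alpha>\<close> by
  \<open>\<phi>\<close> in the disjunction, the second, after swapping, replaces
  \<open>\<beta>\<close>.\<close>

lemma proof_by_cases:
  assumes "insert \<alpha> T \<tturnstile> \<phi>" "insert \<beta> T \<tturnstile> \<phi>" "T \<tturnstile> \<alpha> \<^bold>\<or> \<beta>"
  shows "T \<tturnstile> \<phi>"
proof -
  have "T \<tturnstile> \<phi> \<^bold>\<or> \<beta>"
    using assms proof_by_cases_weak by blast
  then have "T \<tturnstile> \<beta> \<^bold>\<or> \<phi>"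
    by (meson Join_ge1 Join_ge2 Join_least derives.mp)
  then have "T \<tturnstile> \<phi> \<^bold>\<or> \<phi>"
    using assms proof_by_cases_weak by blast
  then show ?thesis
    by (meson Join_least derives.mp imp_refl)
qed

text \<open>Were neither implication provable, maximality would make \<open>\<phi>\<close> provable
  after adding either one to \<open>T\<close>. Their disjunction is a theorem, so
  \<open>proof_by_cases\<close> would give \<open>\<phi>\<close> from \<open>T\<close>
  itself.\<close>

lemma linear_extension:
  assumes "\<not> \<Gamma> \<tturnstile> \<phi>"
  obtains T where "\<Gamma> \<subseteq> T" "\<not> T \<tturnstile> \<phi>" "\<And>\<alpha> \<beta>. T \<tturnstile> \<alpha> \<^bold>\<longrightarrow> \<beta> \<or> T \<tturnstile> \<beta> \<^bold>\<longrightarrow> \<alpha>"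
proof -
  let ?S = "{T. \<Gamma> \<subseteq> T \<and> \<not> T \<tturnstile> \<phi>}"
  have "\<exists>M\<in>?S. \<forall>X\<in>?S. M \<subseteq> X \<longrightarrow> X = M"
  proof (rule subset_Zorn_nonempty)
    show "?S \<noteq> {}"
      using assms by blast
    fix C
    assume C: "C \<noteq> {}" "subset.chain ?S C"
    then have S: "\<Gamma> \<subseteq> T" "\<not> T \<tturnstile> \<phi>" if "T \<in> C" for T
      using that by (auto simp: subset_chain_def)
    have "\<Gamma> \<subseteq> \<Union>C"
      using S(1) C(1) by blast
    moreover have "\<not> \<Union>C \<tturnstile> \<phi>"
      using S(2) derives_Union_chain[OF _ C(2,1)] by blast
    ultimately show "\<Union>C \<in> ?S"
      by simp
  qed
  then obtain T where "T \<in> ?S" and max: "\<forall>X\<in>?S. T \<subseteq> X \<longrightarrow> X = T"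
    by (rule bexE)
  then have T: "\<Gamma> \<subseteq> T" "\<not> T \<tturnstile> \<phi>"
    by simp_all
  have ins: "insert \<alpha> T \<tturnstile> \<phi>" if "\<not> T \<tturnstile> \<alpha>" for \<alpha>
  proof (rule ccontr)
    assume "\<not> insert \<alpha> T \<tturnstile> \<phi>"
    then have "insert \<alpha> T = T"
      using max[rule_format, of "insert \<alpha> T"] T(1) by auto
    then have "\<alpha> \<in> T"
      by blast
    then show False
      using that derives.hyp by blast
  qed
  have "T \<tturnstile> (\<alpha> \<^bold>\<longrightarrow> \<beta>) \<^bold>\<or> (\<beta> \<^bold>\<longrightarrow> \<alpha>)" for \<alpha> \<beta>
    by (rule prelinear_cases[OF Join_ge1 Join_ge2])
  then have "T \<tturnstile> \<alpha> \<^bold>\<longrightarrow> \<beta> \<or> T \<tturnstile> \<beta> \<^bold>\<longrightarrow> \<alpha>" for \<alpha> \<beta>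
    using ins T(2) proof_by_cases[of "\<alpha> \<^bold>\<longrightarrow> \<beta>" T \<phi> "\<beta> \<^bold>\<longrightarrow> \<alpha>"] by blast
  then show thesis
    by (rule that[OF T])
qed

section \<open>Strong completeness\<close>

instance fm :: countable
  by countable_datatype

text \<open>\<open>g x\<close> is the sum of \<open>(1/2) ^ n\<close> over the indices
  \<open>n\<close> of elements strictly below \<open>x\<close>. If \<open>x\<close> is strictly
  above \<open>y\<close>, the index of \<open>y\<close> counts for \<open>x\<close> but, by
  reflexivity, not for \<open>y\<close>.\<close>

lemma countable_total_preorder_embeds_real:
  fixes R :: "'a::countable \<Rightarrow> 'a \<Rightarrow> bool"
  assumes total: "\<And>x y. R x y \<or> R y x" and trans: "\<And>x y z. R x y \<Longrightarrow> R y z \<Longrightarrow> R x z"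
  obtains g :: "'a \<Rightarrow> real" where "\<And>x y. g x \<le> g y \<longleftrightarrow> R x y"
proof -
  define f :: "'a \<Rightarrow> nat \<Rightarrow> real"
    where "f x n = (if R x (from_nat n) then 0 else (1/2) ^ n)" for x n
  have summ: "summable (f x)" for x
  proof (rule summable_comparison_test)
    show "summable (\<lambda>n. (1/2) ^ n :: real)"
      by (rule summable_geometric) simp
    show "\<exists>N. \<forall>n\<ge>N. norm (f x n) \<le> (1/2) ^ n"
      by (auto simp: f_def)
  qed
  have mono: "f x n \<le> f y n" if "R x y" for x y n
    using that trans by (auto simp: f_def)
  have "suminf (f x) \<le> suminf (f y) \<longleftrightarrow> R x y" for x y
  proof
    show "suminf (f x) \<le> suminf (f y)" if "R x y"
      using that mono summ by (intro suminf_le) auto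
    show "R x y" if le: "suminf (f x) \<le> suminf (f y)"
    proof (rule ccontr)
      assume nR: "\<not> R x y"
      then have yx: "R y x"
        using total by blast
      have "0 < (\<Sum>n. f x n - f y n)"
      proof (rule suminf_pos2[of _ "to_nat y"])
        show "summable (\<lambda>n. f x n - f y n)"
          by (intro summable_diff summ)
        show "0 \<le> f x n - f y n" for n
          using mono[OF yx] by simp
        show "0 < f x (to_nat y) - f y (to_nat y)"
          using nR total[of y y] by (simp add: f_def)
      qed
      then show False
        using le by (simp add: suminf_diff[OF summ summ, symmetric])
    qed
  qed
  then show thesis
    by (rule that)
qed

section \<open>Evaluating a linear theory in \<open>dp_algebra c\<close>\<close>

context
  fixes T :: "fm set"
  assumes linear: "\<And>\<alpha> \<beta>. T \<tturnstile> \<alpha> \<^bold>\<longrightarrow> \<beta> \<or> T \<tturnstile> \<beta> \<^bold>\<longrightarrow> \<alpha>"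
begin

text \<open>In a linear theory a provable disjunction collapses to its larger disjunct. For the DP
  axiom, a collapse to \<open>\<alpha>\<close> is excluded.\<close>

lemma square_Bot:
  assumes "\<not> T \<tturnstile> \<alpha>"
  shows "T \<tturnstile> \<alpha> \<^bold>& \<alpha> \<^bold>\<longrightarrow> Bot"
proof -
  let ?\<beta> = "\<alpha> \<^bold>& \<alpha> \<^bold>\<longrightarrow> Bot"
  have J: "T \<tturnstile> \<alpha> \<^bold>\<or> ?\<beta>"
    using derives.ext[of "\<alpha> \<^bold>\<or> \<^bold>\<not> (\<alpha> \<^bold>& \<alpha>)" DP T] by (auto simp: DP_def Neg_def)
  from linear[of \<alpha> ?\<beta>] show ?thesis
    using J assms by (meson Join_least derives.mp imp_refl)
qed

text \<open>By linearity the product lies below the square of the larger factor.\<close>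

lemma Conj_Bot:
  assumes "\<not> T \<tturnstile> \<alpha>" "\<not> T \<tturnstile> \<beta>"
  shows "T \<tturnstile> \<alpha> \<^bold>& \<beta> \<^bold>\<longrightarrow> Bot"
  using linear[of \<alpha> \<beta>]
  by (meson Conj_commute Conj_mono assms imp_trans square_Bot)

lemma largest_unprovable:
  assumes "\<not> T \<tturnstile> \<phi>"
  obtains \<delta> where "\<not> T \<tturnstile> \<delta>" "\<And>\<alpha>. \<not> T \<tturnstile> \<alpha> \<Longrightarrow> T \<tturnstile> \<alpha> \<^bold>\<longrightarrow> \<delta>"
proof (cases "\<exists>\<chi>. \<not> T \<tturnstile> \<chi> \<and> \<not> T \<tturnstile> \<chi> \<^bold>\<longrightarrow> Bot")
  case True
  then obtain \<chi> where "\<not> T \<tturnstile> \<chi>" "\<not> T \<tturnstile> \<chi> \<^bold>\<longrightarrow> Bot"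
    by blast
  then show thesis
    using that Conj_Bot residuate by blast
next
  case False
  \<comment> \<open>Here every unprovable formula is refutable, so \<open>Bot\<close> serves as
    \<open>\<delta>\<close>; it is unprovable because \<open>T\<close> is consistent.\<close>
  moreover have "\<not> T \<tturnstile> Bot"
    using assms Bot_le derives.mp by blast
  ultimately show thesis
    using that by blast
qed

lemma linear_theory_evaluation:
  assumes c: "0 < c" "c < 1" and \<phi>: "\<not> T \<tturnstile> \<phi>"
  obtains v where "range v \<subseteq> carrier (dp_algebra c)"
    "\<And>\<alpha>. eval (dp_algebra c) v \<alpha> = 1 \<longleftrightarrow> T \<tturnstile> \<alpha>"
proof -
  obtain g0 :: "fm \<Rightarrow> real" where g0: "\<And>\<alpha> \<beta>. g0 \<alpha> \<le> g0 \<beta> \<longleftrightarrow> T \<tturnstile> \<alpha> \<^bold>\<longrightarrow> \<beta>"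
    using countable_total_preorder_embeds_real[of "\<lambda>\<alpha> \<beta>. T \<tturnstile> \<alpha> \<^bold>\<longrightarrow> \<beta>"] linear imp_trans
    by blast
  \<comment> \<open>The shift sends \<open>Bot\<close> to 0, the zero of the target algebra.\<close>
  define g where "g \<alpha> = g0 \<alpha> - g0 Bot" for \<alpha>
  have g: "g \<alpha> \<le> g \<beta> \<longleftrightarrow> T \<tturnstile> \<alpha> \<^bold>\<longrightarrow> \<beta>" for \<alpha> \<beta>
    by (simp add: g_def g0)
  have g_Bot: "g Bot = 0" and g_nonneg: "0 \<le> g \<alpha>" for \<alpha>
    using Bot_le by (simp_all add: g_def g0)
  obtain \<delta> where \<delta>: "\<not> T \<tturnstile> \<delta>" "\<And>\<alpha>. \<not> T \<tturnstile> \<alpha> \<Longrightarrow> T \<tturnstile> \<alpha> \<^bold>\<longrightarrow> \<delta>"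
    using largest_unprovable[OF \<phi>] by blast
  \<comment> \<open>If every unprovable formula is refutable, then \<open>g \<delta> = 0\<close> and the quotient is \<open>0\<close>,
    which is the intended value.\<close>
  define h where "h \<alpha> = (if T \<tturnstile> \<alpha> then 1 else c * (g \<alpha> / g \<delta>))" for \<alpha>
  have quot: "0 \<le> g \<alpha> / g \<delta>" "g \<alpha> / g \<delta> \<le> 1" if "\<not> T \<tturnstile> \<alpha>" for \<alpha>
    using g[of \<alpha> \<delta>] \<delta> that g_nonneg[of \<alpha>] g_nonneg[of \<delta>] by (auto simp: divide_le_eq_1)
  have h_unprov: "0 \<le> h \<alpha>" "h \<alpha> \<le> c" "h \<alpha> < 1" if "\<not> T \<tturnstile> \<alpha>" for \<alpha>
  proof -
    show "0 \<le> h \<alpha>"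
      using mult_nonneg_nonneg[OF _ quot(1)[OF that], of c] that c by (simp add: h_def)
    show "h \<alpha> \<le> c"
      using quot(2)[OF that] that c mult_left_le[of "g \<alpha> / g \<delta>" c] by (simp add: h_def)
    then show "h \<alpha> < 1"
      using c by simp
  qed
  have h1: "h \<alpha> = 1 \<longleftrightarrow> T \<tturnstile> \<alpha>" for \<alpha>
    using h_unprov[of \<alpha>] by (auto simp: h_def)
  have h_less: "h \<alpha> < 1 \<longleftrightarrow> \<not> T \<tturnstile> \<alpha>" for \<alpha>
    using h_unprov[of \<alpha>] by (auto simp: h_def)
  \<comment> \<open>Protects the divisions by \<open>g \<delta>\<close>: in this situation 0 \<le>
    \<open>g \<beta>\<close> < \<open>g \<alpha>\<close> \<le> \<open>g \<delta>\<close>.\<close>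
  have g_pos: "0 < g \<delta>" if "\<not> T \<tturnstile> \<alpha>" "\<not> T \<tturnstile> \<alpha> \<^bold>\<longrightarrow> \<beta>" for \<alpha> \<beta>
    using g[of \<alpha> \<delta>] g[of \<alpha> \<beta>] \<delta>(2)[OF that(1)] that(2) g_nonneg[of \<beta>] by auto
  have h_le: "h \<alpha> \<le> h \<beta> \<longleftrightarrow> T \<tturnstile> \<alpha> \<^bold>\<longrightarrow> \<beta>" for \<alpha> \<beta>
  proof (cases "T \<tturnstile> \<beta>")
    case True
    then show ?thesis
      using weaken h_unprov[of \<alpha>] by (auto simp: h_def)
  next
    case nb: False
    show ?thesis
    proof (cases "T \<tturnstile> \<alpha>")
      case True
      then show ?thesis
        using nb h_unprov(3)[OF nb] derives.mp[OF True, of \<beta>] by (auto simp: h_def)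
    next
      case na: False
      have "h \<alpha> \<le> h \<beta>" if "T \<tturnstile> \<alpha> \<^bold>\<longrightarrow> \<beta>"
        using that na nb c g g_nonneg by (simp add: h_def divide_right_mono)
      moreover have "h \<beta> < h \<alpha>" if "\<not> T \<tturnstile> \<alpha> \<^bold>\<longrightarrow> \<beta>"
        using that na nb c g[of \<alpha> \<beta>] g_pos[OF na that] by (simp add: h_def divide_strict_right_mono)
      ultimately show ?thesis
        by force
    qed
  qed
  have h_eqI: "h \<alpha> = h \<beta>" if "T \<tturnstile> \<alpha> \<^bold>\<longrightarrow> \<beta>" "T \<tturnstile> \<beta> \<^bold>\<longrightarrow> \<alpha>" for \<alpha> \<beta>
    using that h_le by (simp add: order_antisym)
  have h_Bot: "h Bot = 0"
    using \<phi> derives.mp[OF _ Bot_le, of T \<phi>] g_Bot by (auto simp: h_def)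
  have h_Conj: "h (\<alpha> \<^bold>& \<beta>) = (if h \<alpha> < 1 \<and> h \<beta> < 1 then 0 else min (h \<alpha>) (h \<beta>))" for \<alpha> \<beta>
  proof -
    have unit: "h (\<alpha> \<^bold>& \<beta>) = h \<beta>" "h (\<beta> \<^bold>& \<alpha>) = h \<beta>" "h \<beta> \<le> h \<alpha>" if "T \<tturnstile> \<alpha>" for \<alpha> \<beta>
    proof -
      have "T \<tturnstile> \<beta> \<^bold>\<longrightarrow> \<alpha> \<^bold>& \<beta>"
        using derives.mp[OF that] residuate imp_refl by blast
      then show "h (\<alpha> \<^bold>& \<beta>) = h \<beta>" "h (\<beta> \<^bold>& \<alpha>) = h \<beta>"
        by (meson Conj_commute Conj_le1 h_eqI imp_trans)+
      show "h \<beta> \<le> h \<alpha>"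
        using that by (simp add: h_le weaken)
    qed
    show ?thesis
    proof (cases "T \<tturnstile> \<alpha> \<or> T \<tturnstile> \<beta>")
      case True
      then show ?thesis
        using unit[of \<alpha> \<beta>] unit[of \<beta> \<alpha>] by (auto simp: h_less)
    next
      case False
      then have "h (\<alpha> \<^bold>& \<beta>) = h Bot"
        using Conj_Bot Bot_le by (blast intro: h_eqI)
      then show ?thesis
        using False by (simp add: h_less h_Bot)
    qed
  qed
  have h_Meet: "h (\<alpha> \<^bold>\<and> \<beta>) = min (h \<alpha>) (h \<beta>)" for \<alpha> \<beta>
  proof (rule antisym)
    show "h (\<alpha> \<^bold>\<and> \<beta>) \<le> min (h \<alpha>) (h \<beta>)"
      by (simp add: h_le Meet_le1 Meet_le2)
    show "min (h \<alpha>) (h \<beta>) \<le> h (\<alpha> \<^bold>\<and> \<beta>)"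
      using Meet_greatest[OF imp_refl, of T \<alpha> \<beta>] Meet_greatest[OF _ imp_refl, of T \<beta> \<alpha>]
        linear[of \<alpha> \<beta>] by (auto simp: min_def h_le)
  qed
  have h_Imp: "h (\<alpha> \<^bold>\<longrightarrow> \<beta>) = (if h \<alpha> \<le> h \<beta> then 1 else if h \<alpha> < 1 then c else h \<beta>)" for \<alpha> \<beta>
  proof (cases "T \<tturnstile> \<alpha> \<^bold>\<longrightarrow> \<beta>")
    case True
    then show ?thesis
      by (simp add: h_le h1)
  next
    case False
    show ?thesis
    proof (cases "T \<tturnstile> \<alpha>")
      case True
      then have "h (\<alpha> \<^bold>\<longrightarrow> \<beta>) = h \<beta>"
        using derives.mp[OF True modus_ponens_imp] weakening by (intro h_eqI)
      then show ?thesis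
        using True False by (simp add: h_le h_less)
    next
      case na: False
      \<comment> \<open>The product of \<open>\<delta>\<close> and \<open>\<alpha>\<close> is
        refutable, so the unprovable implication is equivalent to \<open>\<delta>\<close>, whose
        value is \<open>c\<close>: the middle case of the residuum.\<close>
      have "T \<tturnstile> \<delta> \<^bold>\<longrightarrow> \<alpha> \<^bold>\<longrightarrow> \<beta>"
        using Conj_Bot[OF \<delta>(1) na] Bot_le imp_trans residuate by blast
      then have "h (\<alpha> \<^bold>\<longrightarrow> \<beta>) = h \<delta>"
        using \<delta>(2) False by (blast intro: h_eqI)
      also have "\<dots> = c"
        using \<delta>(1) g_pos[OF na False] by (simp add: h_def)
      finally show ?thesis
        using na False by (simp add: h_le h_less)
    qed
  qed
  \<comment> \<open>\<open>h\<close> commutes with all connectives, so it is the evaluation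
    determined by its values on variables.\<close>
  have "eval (dp_algebra c) (\<lambda>n. h (Var n)) \<alpha> = h \<alpha>" for \<alpha>
    by (induction \<alpha>) (simp_all add: h_Bot h_Conj h_Meet h_Imp)
  moreover have "h \<alpha> \<in> carrier (dp_algebra c)" for \<alpha>
    using h_unprov[of \<alpha>] h1[of \<alpha>] by auto
  ultimately show thesis
    by (intro that[of "\<lambda>n. h (Var n)"]) (auto simp only: h1)
qed

end

theorem DP_strongly_complete:
  assumes c: "0 < c" "c < 1"
  shows "\<Gamma> \<tturnstile> \<phi> \<longleftrightarrow> entails (dp_algebra c) \<Gamma> \<phi>"
proof
  show "entails (dp_algebra c) \<Gamma> \<phi>" if "\<Gamma> \<tturnstile> \<phi>"
    using soundness[OF dp_algebra_in_variety[OF c] that] .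
  show "\<Gamma> \<tturnstile> \<phi>" if ent: "entails (dp_algebra c) \<Gamma> \<phi>"
  proof (rule ccontr)
    assume "\<not> \<Gamma> \<tturnstile> \<phi>"
    then obtain T where T: "\<Gamma> \<subseteq> T" "\<not> T \<tturnstile> \<phi>" "\<And>\<alpha> \<beta>. T \<tturnstile> \<alpha> \<^bold>\<longrightarrow> \<beta> \<or> T \<tturnstile> \<beta> \<^bold>\<longrightarrow> \<alpha>"
      using linear_extension by blast
    obtain v where v: "range v \<subseteq> carrier (dp_algebra c)"
      "\<And>\<alpha>. eval (dp_algebra c) v \<alpha> = 1 \<longleftrightarrow> T \<tturnstile> \<alpha>"
      using linear_theory_evaluation[OF T(3) c T(2)] by blast
    have "\<forall>\<gamma>\<in>\<Gamma>. eval (dp_algebra c) v \<gamma> = one (dp_algebra c)"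
      using v(2) T(1) derives.hyp by auto
    then have "eval (dp_algebra c) v \<phi> = one (dp_algebra c)"
      using ent v(1) unfolding entails_def by blast
    then show False
      using v(2) T(2) by simp
  qed
qed

section \<open>The variety of DP-algebras\<close>

text \<open>Unit and join are primitive in terms but defined in formulas. In an MTL-algebra the
  definitions agree with the primitives, so the translation preserves values there.\<close>

primrec fm_of_trm :: "trm \<Rightarrow> fm" where
  "fm_of_trm (TVar n) = Var n"
| "fm_of_trm TZero = Bot"
| "fm_of_trm TOne = \<^bold>\<not> Bot"
| "fm_of_trm (TMult s t) = fm_of_trm s \<^bold>& fm_of_trm t"
| "fm_of_trm (TResid s t) = fm_of_trm s \<^bold>\<longrightarrow> fm_of_trm t"
| "fm_of_trm (TMeet s t) = fm_of_trm s \<^bold>\<and> fm_of_trm t"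
| "fm_of_trm (TJoin s t) = fm_of_trm s \<^bold>\<or> fm_of_trm t"

primrec trm_of_fm :: "fm \<Rightarrow> trm" where
  "trm_of_fm (Var n) = TVar n"
| "trm_of_fm Bot = TZero"
| "trm_of_fm (\<phi> \<^bold>& \<psi>) = TMult (trm_of_fm \<phi>) (trm_of_fm \<psi>)"
| "trm_of_fm (\<phi> \<^bold>\<and> \<psi>) = TMeet (trm_of_fm \<phi>) (trm_of_fm \<psi>)"
| "trm_of_fm (\<phi> \<^bold>\<longrightarrow> \<psi>) = TResid (trm_of_fm \<phi>) (trm_of_fm \<psi>)"

lemma teval_trm_of_fm [simp]: "teval A v (trm_of_fm \<phi>) = eval A v \<phi>"
  by (induction \<phi>) simp_all

lemma (in mtl_algebra) teval_closed: "range v \<subseteq> carrier A \<Longrightarrow> teval A v t \<in> carrier A"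
  by (induction t) auto

lemma (in mtl_algebra) eval_fm_of_trm:
  assumes v: "range v \<subseteq> carrier A"
  shows "eval A v (fm_of_trm t) = teval A v t"
  by (induction t) (simp_all add: eval_Join[OF v] Neg_def resid_eq_one)

text \<open>By antisymmetry an identity amounts to two implications. This carries equations into the
  logic, where soundness and completeness apply.\<close>

lemma (in mtl_algebra) teval_eq_iff:
  assumes v: "range v \<subseteq> carrier A"
  shows "teval A v s = teval A v t \<longleftrightarrow>
    eval A v (fm_of_trm s \<^bold>\<longrightarrow> fm_of_trm t) = one A \<and> eval A v (fm_of_trm t \<^bold>\<longrightarrow> fm_of_trm s) = one A"
  using le_antisym[of "teval A v s" "teval A v t"] teval_closed[OF v, of s] teval_closed[OF v, of t]
  by (auto simp: eval_fm_of_trm[OF v] resid_eq_one)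

text \<open>The three equations before the last one replace the residuation equivalence: distributivity
  makes the product monotone, the other two are the counit and the unit of the adjunction.\<close>

definition mtl_equations :: "(trm \<times> trm) set" where
  "mtl_equations = (let x = TVar 0; y = TVar 1; z = TVar 2 in {
    (TMeet x y, TMeet y x), (TJoin x y, TJoin y x),
    (TMeet (TMeet x y) z, TMeet x (TMeet y z)), (TJoin (TJoin x y) z, TJoin x (TJoin y z)),
    (TMeet x (TJoin x y), x), (TJoin x (TMeet x y), x),
    (TMeet TZero x, TZero), (TMeet x TOne, x),
    (TMult x y, TMult y x), (TMult (TMult x y) z, TMult x (TMult y z)), (TMult x TOne, x),
    (TMult x (TJoin y z), TJoin (TMult x y) (TMult x z)),
    (TMeet (TMult x (TResid x y)) y, TMult x (TResid x y)),
    (TMeet z (TResid x (TJoin (TMult x z) y)), z),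
    (TJoin (TResid x y) (TResid y x), TOne)})"

text \<open>Multiplication by a fixed element is a left adjoint, hence preserves joins.\<close>

lemma (in mtl_algebra) mult_join_distrib:
  assumes "x \<in> carrier A" "y \<in> carrier A" "z \<in> carrier A"
  shows "mult A x (join A y z) = join A (mult A x y) (mult A x z)"
proof (rule le_antisym)
  have "le A (join A y z) (resid A x (join A (mult A x y) (mult A x z)))"
    using assms by (intro join_least) (simp_all add: join_ge1 join_ge2 flip: residuation)
  then show "le A (mult A x (join A y z)) (join A (mult A x y) (mult A x z))"
    using assms by (simp add: residuation)
  show "le A (join A (mult A x y) (mult A x z)) (mult A x (join A y z))"
    using assms by (intro join_least mult_mono) (simp_all add: join_ge1 join_ge2)
qed (use assms in simp_all)

lemma mtl_algebra_satisfies_mtl_equations: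
  assumes "mtl_algebra A"
  shows "A \<in> equational_class mtl_equations"
proof -
  interpret mtl_algebra A by fact
  have "teval A v s = teval A v t" if "(s, t) \<in> mtl_equations" "range v \<subseteq> carrier A" for s t v
  proof -
    have v: "v n \<in> carrier A" for n
      using that(2) by auto
    have unit: "meet A z (resid A x (join A (mult A x z) y)) = z"
      if "x \<in> carrier A" "y \<in> carrier A" "z \<in> carrier A" for x y z
      using that by (simp add: join_ge1 flip: le_def residuation)
    have counit: "meet A (mult A x (resid A x y)) y = mult A x (resid A x y)"
      if "x \<in> carrier A" "y \<in> carrier A" for x y
      using that modus_ponens_le by (simp flip: le_def)
    show ?thesis
      using that(1) v unfolding mtl_equations_def Let_def
      by (elim insertE emptyE)
        (simp_all add: meet_assoc join_assoc meet_absorb join_absorb mult_assoc mult_one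
          prelinear mult_join_distrib unit counit zero_least[unfolded le_def]
          one_greatest[unfolded le_def], (metis meet_comm join_comm mult_comm)+)
  qed
  then show ?thesis
    using sig_algebra_axioms by (auto simp: equational_class_def)
qed

lemma mtl_equations_imp_mtl_algebra:
  assumes "A \<in> equational_class mtl_equations"
  shows "mtl_algebra A"
proof -
  interpret sig_algebra A
    using assms by (simp add: equational_class_def)
  have ax: "meet A x y = meet A y x \<and> join A x y = join A y x \<and>
    meet A (meet A x y) z = meet A x (meet A y z) \<and> join A (join A x y) z = join A x (join A y z) \<and>
    meet A x (join A x y) = x \<and> join A x (meet A x y) = x \<and>
    meet A (zero A) x = zero A \<and> meet A x (one A) = x \<and>
    mult A x y = mult A y x \<and> mult A (mult A x y) z = mult A x (mult A y z) \<and> mult A x (one A) = x \<and>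
    mult A x (join A y z) = join A (mult A x y) (mult A x z) \<and>
    meet A (mult A x (resid A x y)) y = mult A x (resid A x y) \<and>
    meet A z (resid A x (join A (mult A x z) y)) = z \<and>
    join A (resid A x y) (resid A y x) = one A"
    if "x \<in> carrier A" "y \<in> carrier A" "z \<in> carrier A" for x y z
  proof -
    define v where "v n = (if n = 0 then x else if n = 1 then y else z)" for n :: nat
    have "range v \<subseteq> carrier A"
      using that by (auto simp: v_def)
    then have "\<forall>(s, t)\<in>mtl_equations. teval A v s = teval A v t"
      using assms by (auto simp: equational_class_def)
    moreover have "v 0 = x" "v 1 = y" "v 2 = z"
      by (simp_all add: v_def)
    ultimately show ?thesis
      unfolding mtl_equations_def Let_def ball_simps prod.case teval.simps by (elim conjE) (intro conjI; simp only:)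
  qed
  have le_join: "le A x y \<longleftrightarrow> join A x y = y" if "x \<in> carrier A" "y \<in> carrier A" for x y
    using ax[OF that that(1)] ax[OF that(2,1,1)] by (metis le_def)
  have le_trans: "le A x z"
    if "le A x y" "le A y z" "x \<in> carrier A" "y \<in> carrier A" "z \<in> carrier A" for x y z
    using ax[OF that(3-5)] that(1,2) by (metis le_def)
  have counit: "le A (mult A x (resid A x y)) y" if "x \<in> carrier A" "y \<in> carrier A" for x y
    using ax[OF that that(1)] by (simp add: le_def)
  show ?thesis
  proof
    fix x y z
    assume xyz: "x \<in> carrier A" "y \<in> carrier A" "z \<in> carrier A"
    show "le A (mult A x z) y \<longleftrightarrow> le A z (resid A x y)"
    proof
      \<comment> \<open>The join in the unit equation is then \<open>y\<close>, which leaves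
        \<open>meet A z (resid A x y) = z\<close>.\<close>
      assume "le A (mult A x z) y"
      then show "le A z (resid A x y)"
        using ax[OF xyz] xyz by (simp add: le_join mult_closed) (simp add: le_def)
    next
      \<comment> \<open>Distributivity makes multiplication by \<open>x\<close> monotone, and the
        counit bounds the resulting product by \<open>y\<close>.\<close>
      assume "le A z (resid A x y)"
      then have "join A z (resid A x y) = resid A x y"
        using xyz by (simp add: le_join resid_closed)
      moreover have "mult A x (join A z (resid A x y)) = join A (mult A x z) (mult A x (resid A x y))"
        using ax[of x z "resid A x y"] xyz by (simp only: resid_closed)
      ultimately have "le A (mult A x z) (mult A x (resid A x y))"
        using xyz by (simp add: le_join mult_closed resid_closed)
      then show "le A (mult A x z) y"
        using counit le_trans xyz mult_closed resid_closed by meson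
    qed
  qed (unfold le_def, (use ax in blast)+)
qed

text \<open>A generated variety is an intersection of equational classes, so it can be bounded by
  \<open>variety_of DP\<close> once the latter is itself such a class.\<close>

lemma variety_of_DP_eq:
  "variety_of DP = equational_class (mtl_equations \<union> (\<lambda>\<phi>. (trm_of_fm \<phi>, TOne)) ` DP)"
proof -
  have "equational_class (mtl_equations \<union> (\<lambda>\<phi>. (trm_of_fm \<phi>, TOne)) ` DP) =
    {A. A \<in> equational_class mtl_equations \<and> (\<forall>\<phi>\<in>DP. entails A {} \<phi>)}"
    by (simp add: equational_class_def entails_def ball_Un conj_assoc)
  then show ?thesis
    using mtl_algebra_satisfies_mtl_equations mtl_equations_imp_mtl_algebra
    by (auto simp: variety_of_def)
qed

text \<open>An equation valid in \<open>dp_algebra c\<close> becomes two valid implications.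
  Completeness makes them theorems of DP, and soundness transfers them to every DP-algebra, whatever
  its carrier type.\<close>

theorem variety_of_DP_generated:
  assumes c: "0 < c" "c < 1"
  shows "variety_of DP = generated_variety {dp_algebra c}"
proof
  show "generated_variety {dp_algebra c} \<subseteq> variety_of DP"
    using dp_algebra_in_variety[OF c] unfolding generated_variety_def variety_of_DP_eq by blast
  show "variety_of DP \<subseteq> generated_variety {dp_algebra c}"
    unfolding generated_variety_def
  proof clarify
    fix B :: "'b alg" and E
    assume B: "B \<in> variety_of DP" and E: "{dp_algebra c} \<subseteq> equational_class E"
    interpret B: mtl_algebra B
      using B by (simp add: variety_of_def)
    interpret A: mtl_algebra "dp_algebra c"
      using c by (rule mtl_algebra_dp_algebra)
    have "teval B w s = teval B w t" if st: "(s, t) \<in> E" and w: "range w \<subseteq> carrier B" for s t w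
    proof -
      have "teval (dp_algebra c) v s = teval (dp_algebra c) v t"
        if "range v \<subseteq> carrier (dp_algebra c)" for v
        using E st that by (auto simp: equational_class_def)
      then have "entails (dp_algebra c) {} (fm_of_trm s \<^bold>\<longrightarrow> fm_of_trm t)"
        "entails (dp_algebra c) {} (fm_of_trm t \<^bold>\<longrightarrow> fm_of_trm s)"
        using A.teval_eq_iff unfolding entails_def by blast+
      then have "entails B {} (fm_of_trm s \<^bold>\<longrightarrow> fm_of_trm t)"
        "entails B {} (fm_of_trm t \<^bold>\<longrightarrow> fm_of_trm s)"
        using soundness[OF B] DP_strongly_complete[OF c] by blast+
      then show ?thesis
        using w B.teval_eq_iff unfolding entails_def by blast
    qed
    then show "B \<in> equational_class E"
      using B.sig_algebra_axioms by (auto simp: equational_class_def)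
  qed
qed

section \<open>Real DP-chains\<close>

text \<open>The DP axiom makes the join of \<open>x\<close> and the negated square equal to
  \<open>one A\<close>. In a chain the join is one of its arguments, and \<open>x\<close> is not
  \<open>one A\<close>.\<close>

lemma DP_chain_square:
  assumes A: "A \<in> variety_of DP" "chain A" and x: "x \<in> carrier A" "x \<noteq> one A"
  shows "mult A x x = zero A"
proof -
  interpret mtl_algebra A
    using A by (simp add: variety_of_def)
  have v: "range (\<lambda>_::nat. x) \<subseteq> carrier A"
    using x by auto
  have "Var 0 \<^bold>\<or> \<^bold>\<not> (Var 0 \<^bold>& Var 0) \<in> DP"
    unfolding DP_def by blast
  then have "entails A {} (Var 0 \<^bold>\<or> \<^bold>\<not> (Var 0 \<^bold>& Var 0))"
    using A(1) by (simp add: variety_of_def)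
  then have "eval A (\<lambda>_. x) (Var 0 \<^bold>\<or> \<^bold>\<not> (Var 0 \<^bold>& Var 0)) = one A"
    using v by (simp add: entails_def)
  then have J: "join A x (resid A (mult A x x) (zero A)) = one A"
    by (simp add: eval_Join[OF v] Neg_def)
  let ?r = "resid A (mult A x x) (zero A)"
  have "le A x ?r \<or> le A ?r x"
    using A(2) x by (simp add: chain_def)
  then have "?r = one A"
    using J x le_iff_join[of x ?r] le_iff_join[of ?r x] join_comm[of x ?r] by auto
  then show ?thesis
    using x by (simp add: resid_eq_one le_antisym zero_least)
qed

text \<open>Algebraic counterpart of \<open>largest_unprovable\<close>, with the negation of
  \<open>x\<close> as coatom: for \<open>y\<close> other than \<open>one A\<close>, the product of
  \<open>x\<close> and \<open>y\<close> lies below one of their squares, which are both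
  zero.\<close>

lemma DP_chain_coatom:
  assumes A: "A \<in> variety_of DP" "chain A"
    and x: "x \<in> carrier A" "x \<noteq> zero A" "x \<noteq> one A"
  obtains d where "d \<in> carrier A" "d \<noteq> one A" "\<And>y. y \<in> carrier A \<Longrightarrow> y \<noteq> one A \<Longrightarrow> le A y d"
proof -
  interpret mtl_algebra A
    using A by (simp add: variety_of_def)
  show thesis
  proof (rule that)
    show "resid A x (zero A) \<in> carrier A"
      using x by simp
    show "resid A x (zero A) \<noteq> one A"
      using x le_antisym zero_least by (auto simp: resid_eq_one)
    fix y
    assume y: "y \<in> carrier A" "y \<noteq> one A"
    have "le A x y \<or> le A y x"
      using A(2) x y by (simp add: chain_def)
    then have "le A (mult A x y) (mult A y y) \<or> le A (mult A x y) (mult A x x)"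
      using x y mult_mono by (metis mult_comm)
    then have "le A (mult A x y) (zero A)"
      using DP_chain_square[OF A] x y by auto
    then show "le A y (resid A x (zero A))"
      using x y by (simp add: residuation)
  qed
qed

section \<open>Failure of standard completeness\<close>

lemma real_sublattice_le:
  assumes "real_sublattice A" "x \<in> carrier A" "y \<in> carrier A"
  shows "le A x y \<longleftrightarrow> x \<le> y"
  using assms by (auto simp: real_sublattice_def le_def min_def)

lemma no_standard_DP_algebra: "\<not> standard_algebra DP A"
proof
  assume "standard_algebra DP A"
  then have A: "A \<in> variety_of DP" "chain A" and r: "real_sublattice A" and C: "carrier A = {0..1}"
    by (auto simp: standard_algebra_def)
  interpret mtl_algebra A
    using A by (simp add: variety_of_def)
  have le: "le A x y \<longleftrightarrow> x \<le> y" if "x \<in> {0..1}" "y \<in> {0..1}" for x y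
    using real_sublattice_le[OF r] that C by simp
  \<comment> \<open>\<open>standard_algebra\<close> prescribes the carrier and the lattice
    operations; the constants are recovered from the order.\<close>
  have "zero A = 0" "one A = 1"
    using zero_least[of 0] one_greatest[of 1] zero_closed one_closed le[of "zero A" 0] le[of 1 "one A"] C
    by auto
  then obtain d where d: "d \<in> {0..1}" "d \<noteq> 1" "\<And>y. y \<in> {0..1} \<Longrightarrow> y \<noteq> 1 \<Longrightarrow> le A y d"
    using DP_chain_coatom[OF A, of "1/2"] C by auto
  \<comment> \<open>The midpoint of the coatom and 1 would have to lie below the coatom.\<close>
  have "(d + 1) / 2 \<le> d"
    using d(1,2) d(3)[of "(d + 1) / 2"] le[of "(d + 1) / 2" d] by auto
  then show False
    using d(1,2) by auto
qed

text \<open>A generating set of standard algebras must be empty, and the empty set generates the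
  trivial variety, whereas \<open>dp_algebra (1/2)\<close> is a nontrivial DP-algebra.\<close>

lemma DP_not_standard_complete: "\<not> standard_complete TYPE(real) DP"
proof
  assume "standard_complete TYPE(real) DP"
  then obtain K where "\<forall>A\<in>K. standard_algebra DP A"
    and K: "(variety_of DP :: real alg set) = generated_variety K"
    by (auto simp: standard_complete_def)
  then have "K = {}"
    using no_standard_DP_algebra by blast
  \<comment> \<open>Every equational class contains the empty set, even the one given by the
    equation of two distinct variables.\<close>
  then have "dp_algebra (1/2) \<in> equational_class {(TVar 0, TVar 1)}"
    using dp_algebra_in_variety[of "1/2"] K unfolding generated_variety_def by auto
  moreover have "range (\<lambda>n. if n = 0 then 0 else 1) \<subseteq> carrier (dp_algebra (1/2))"
    by auto
  ultimately have "teval (dp_algebra (1/2)) (\<lambda>n. if n = 0 then 0 else 1) (TVar 0) =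
      teval (dp_algebra (1/2)) (\<lambda>n. if n = 0 then 0 else 1) (TVar 1)"
    unfolding equational_class_def by blast
  then show False
    by simp
qed

section \<open>Canonical completeness\<close>

lemma real_DP_chain_subset:
  assumes B: "B \<in> variety_of DP" "chain B" "real_sublattice B"
  obtains a d t where "a < d" "d < t" "carrier B \<subseteq> {a..d} \<union> {t}"
proof -
  interpret mtl_algebra B
    using B by (simp add: variety_of_def)
  note le = real_sublattice_le[OF B(3)]
  have lo: "zero B \<le> x" and hi: "x \<le> one B" if "x \<in> carrier B" for x
    using that zero_least one_greatest le by auto
  \<comment> \<open>The coatom exists only given an element other than the bounds, so chains with at
    most two elements are treated apart.\<close>
  consider (mid) x where "x \<in> carrier B" "x \<noteq> zero B" "x \<noteq> one B"
    | (two) "carrier B = {zero B, one B}" "zero B < one B" | (triv) "carrier B = {zero B}"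
    using lo[of "one B"] zero_closed one_closed by fastforce
  then show thesis
  proof cases
    case mid
    obtain d where d: "d \<in> carrier B" "d \<noteq> one B"
      "\<And>y. y \<in> carrier B \<Longrightarrow> y \<noteq> one B \<Longrightarrow> le B y d"
      using DP_chain_coatom[OF B(1,2) mid] by blast
    have "x \<le> d"
      using d mid le by blast
    then have "zero B < d" "d < one B"
      using lo[OF mid(1)] mid(2) hi[OF d(1)] d(2) by auto
    moreover have "y \<le> d \<or> y = one B" if "y \<in> carrier B" for y
      using that d(1) d(3)[OF that] le by blast
    then have "carrier B \<subseteq> {zero B..d} \<union> {one B}"
      using lo unfolding subset_iff Un_iff atLeastAtMost_iff singleton_iff by blast
    ultimately show thesis
      using that by blast
  next
    case two
    then show thesis
      using that[of "zero B" "(zero B + one B) / 2" "one B"] by auto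
  next
    case triv
    \<comment> \<open>The bounds coincide, so \<open>d\<close> and \<open>t\<close> are padding
      above them; the algebra containing \<open>B\<close> is not confined to
      \<open>[0,1]\<close>.\<close>
    then show thesis
      using that[of "zero B" "zero B + 1" "zero B + 2"] by auto
  qed
qed

text \<open>\<open>sublattice\<close> compares lattice operations only, so the containing algebra
  just needs the right order; product and residuum are transported from
  \<open>dp_algebra c\<close>.\<close>

lemma dp_algebra_transport:
  fixes a d t :: real
  assumes c: "0 < c" "c < 1" and "a < d" "d < t"
  obtains A' :: "real alg" where "isomorphic A' (dp_algebra c)" "carrier A' = {a..d} \<union> {t}"
    "meet A' = min" "join A' = max"
proof -
  interpret mtl_algebra "dp_algebra c"
    using c by (rule mtl_algebra_dp_algebra)
  let ?S = "{a..d} \<union> {t}" and ?A = "dp_algebra c"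
  \<comment> \<open>\<open>h\<close> maps \<open>{a..d}\<close> affinely onto \<open>{0..c}\<close>
    and \<open>t\<close> to 1; \<open>k\<close> is its inverse.\<close>
  define h where "h x = (if x \<le> d then c * ((x - a) / (d - a)) else 1)" for x
  define k where "k y = (if y \<le> c then a + (d - a) * (y / c) else t)" for y
  have hk: "h (k y) = y" "k y \<in> ?S" if "y \<in> carrier ?A" for y
  proof -
    have "(d - a) * (y / c) \<le> d - a" if "0 \<le> y" "y \<le> c"
      using that assms mult_left_le[of "y / c" "d - a"] by simp
    then show "h (k y) = y" "k y \<in> ?S"
      using that assms by (auto simp: h_def k_def)
  qed
  have kh: "k (h x) = x" "h x \<in> carrier ?A" if "x \<in> ?S" for x
  proof -
    have "c * ((x - a) / (d - a)) \<le> c" if "a \<le> x" "x \<le> d"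
      using that assms mult_left_le[of "(x - a) / (d - a)" c] by simp
    then show "k (h x) = x" "h x \<in> carrier ?A"
      using that assms by (auto simp: h_def k_def)
  qed
  have bij: "bij_betw h ?S (carrier ?A)"
    by (rule bij_betw_byWitness[where f' = k]) (intro ballI image_subsetI; fact hk kh)+
  have mono: "h x \<le> h y" if "x \<in> ?S" "y \<in> ?S" "x \<le> y" for x y
  proof (cases "y \<le> d")
    case True
    then show ?thesis
      using that assms by (simp add: h_def divide_right_mono)
  next
    case False
    then show ?thesis
      using kh(2)[OF that(1)] c by (auto simp: h_def)
  qed
  \<comment> \<open>Meet and join are those of the reals; \<open>h\<close> preserves them because it
    is monotone.\<close>
  define A' where "A' = \<lparr>carrier = ?S,
    mult = (\<lambda>x y. k (mult ?A (h x) (h y))), resid = (\<lambda>x y. k (resid ?A (h x) (h y))),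
    meet = min, join = max, zero = k 0, one = k 1\<rparr>"
  have "isomorphic A' ?A"
    unfolding isomorphic_def
  proof (intro exI[of _ h] conjI ballI)
    show "bij_betw h (carrier A') (carrier ?A)"
      using bij by (simp add: A'_def)
    show "h (zero A') = zero ?A" "h (one A') = one ?A"
      using hk(1)[OF zero_closed] hk(1)[OF one_closed] by (simp_all add: A'_def)
    fix x y
    assume "x \<in> carrier A'" "y \<in> carrier A'"
    then have xy: "x \<in> ?S" "y \<in> ?S"
      by (simp_all add: A'_def)
    note hxy = kh(2)[OF xy(1)] kh(2)[OF xy(2)]
    show "h (mult A' x y) = mult ?A (h x) (h y)"
      using hk(1)[OF mult_closed[OF hxy]] by (simp add: A'_def)
    show "h (resid A' x y) = resid ?A (h x) (h y)"
      using hk(1)[OF resid_closed[OF hxy]] by (simp add: A'_def)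
    show "h (meet A' x y) = meet ?A (h x) (h y)" "h (join A' x y) = join ?A (h x) (h y)"
      using mono[OF xy] mono[OF xy(2,1)] by (auto simp: A'_def min_def max_def)
  qed
  moreover have "carrier A' = ?S" "meet A' = min" "join A' = max"
    by (simp_all add: A'_def)
  ultimately show thesis
    by (rule that)
qed

lemma DP_canonically_complete: "canonically_complete TYPE('u) DP"
  unfolding canonically_complete_def
proof (rule exI[of _ "dp_algebra (1/2)"], intro conjI allI impI)
  show "dp_algebra (1/2) \<in> variety_of DP"
    by (rule dp_algebra_in_variety) simp_all
  show "{} \<tturnstile> \<phi> \<longleftrightarrow> entails (dp_algebra (1/2)) {} \<phi>" for \<phi>
    by (rule DP_strongly_complete) simp_all
  show "(variety_of DP :: 'u alg set) = generated_variety {dp_algebra (1/2)}"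
    by (rule variety_of_DP_generated) simp_all
  show "real_sublattice (dp_algebra (1/2))"
    by (auto simp: real_sublattice_def)
  fix B :: "real alg"
  assume B: "B \<in> variety_of DP \<and> chain B \<and> real_sublattice B"
  then obtain a d t where adt: "a < d" "d < t" "carrier B \<subseteq> {a..d} \<union> {t}"
    using real_DP_chain_subset by blast
  obtain A' :: "real alg" where "isomorphic A' (dp_algebra (1/2))" "carrier A' = {a..d} \<union> {t}"
    "meet A' = min" "join A' = max"
    using dp_algebra_transport[of "1/2" a d t] adt by auto
  then show "\<exists>A' :: real alg. isomorphic A' (dp_algebra (1/2)) \<and> sublattice B A'"
    using adt B by (auto simp: sublattice_def real_sublattice_def intro!: exI[of _ A'])
qed

theorem theorem10:
  "(\<forall>c::real. 0 < c \<and> c < 1 \<longrightarrow>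
      (\<forall>\<Gamma> \<phi>. derives DP \<Gamma> \<phi> \<longleftrightarrow> entails (dp_algebra c) \<Gamma> \<phi>)) \<and>
   \<not> standard_complete TYPE(real) DP \<and>
   canonically_complete TYPE('u) DP"
  using DP_strongly_complete DP_not_standard_complete DP_canonically_complete by blast

end
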